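(* Let $\nu>0$, let $k\in\{0,1,2,\dots\}$ be such that $\nu\in(k/2,(k+1)/2]$, and let $p\ge1$. Suppose that $f=h+\overline g\in\mathcal{B}^*_H(\nu)$ is a sense-preserving harmonic mapping in $\mathbb{D}$ with dilatation $\omega_f$, where $h(z)=\sum_{n=0}^\infty a_nz^n$ and $g(z)=\sum_{n=1}^\infty b_nz^n$, and $\|f\|_{\mathcal{B}^*_H(\nu)}\le1$. Then $$|a_0|+\sum_{n=1}^\infty(|a_n|^p+|b_n|^p)^{1/p}r^n\le1$$ for $|z|=r\le\max\{r_1(\nu,p,|\omega_f(0)|),\,r_2(k,p,|\omega_f(0)|)\}$. Here $r_1(\nu,p,|\omega_f(0)|)$ is the unique solution in $(0,1)$ to the equation $$3(1-|\omega_f(0)|)(1-r^2)^{2\nu+1}-M_p\pi^2(1+|\omega_f(0)|)r^2=0$$ and $r_2(k,p,|\omega_f(0)|)$ is the unique solution in $(0,1)$ to the equation $$2M_p(1+|\omega_f(0)|)\,rF_{k+1}(r)-(1-|\omega_f(0)|)(1-r)=0,$$ where $M_p=\max\{2^{2/p-1},1\}$, $F_1(r)=\log\frac1{1-r}$, and $F_m(r)=\frac1m\log\frac1{1-r}+\frac1m\sum_{n=1}^{m-1}\frac1n\left(\frac1{(1-r)^n}-1\right)$ for integers $m\ge2$.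
   Context: $\mathbb{D}$ is the open unit disk in $\mathbb{C}$. A harmonic mapping in $\mathbb{D}$ is a complex-valued $f$ with $f_{z\overline z}=0$; its canonical decomposition is $f=h+\overline g$ with $h,g$ analytic in $\mathbb{D}$, $g(0)=0$. Its Jacobian is $J_f=|h'|^2-|g'|^2$. It is sense-preserving when $J_f>0$ in $\mathbb{D}$, i.e. $|g'|<|h'|$; its dilatation is $\omega_f=g'/h'$. For $\nu>0$, $\beta^*_\nu(f)=\sup_{z\in\mathbb{D}}(1-|z|^2)^\nu\sqrt{|J_f(z)|}$, $\mathcal{B}^*_H(\nu)$ is the set of harmonic mappings $f$ in $\mathbb{D}$ with $\beta^*_\nu(f)<\infty$, and $\|f\|_{\mathcal{B}^*_H(\nu)}=|f(0)|+\beta^*_\nu(f)$ (a pseudo-norm). *)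

theory Defs
  imports "HOL-Complex_Analysis.Complex_Analysis"
begin

abbreviation unit_disk :: "complex set" where
  "unit_disk \<equiv> ball 0 1"

text \<open>Wirtinger derivatives \<open>f_z = (f_x - i f_y)/2\<close> and \<open>f_zbar = (f_x + i f_y)/2\<close>;
  the Frechet derivative is over the reals, so its values at \<open>1\<close> and \<open>i\<close> are
  \<open>f_x\<close> and \<open>f_y\<close>.\<close>

definition wirtinger_z :: "(complex \<Rightarrow> complex) \<Rightarrow> complex \<Rightarrow> complex" where
  "wirtinger_z f z = (frechet_derivative f (at z) 1 - \<i> * frechet_derivative f (at z) \<i>) / 2"

definition wirtinger_zbar :: "(complex \<Rightarrow> complex) \<Rightarrow> complex \<Rightarrow> complex" where
  "wirtinger_zbar f z = (frechet_derivative f (at z) 1 + \<i> * frechet_derivative f (at z) \<i>) / 2"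

text \<open>The differentiability clauses only ensure that the derivatives in the equation exist;
  continuity of the second derivatives need not be demanded, see
  \<open>harmonic_mapping_iff\<close> below.\<close>

definition harmonic_mapping :: "(complex \<Rightarrow> complex) \<Rightarrow> bool" where
  "harmonic_mapping f \<longleftrightarrow>
     f differentiable_on unit_disk \<and>
     wirtinger_z f differentiable_on unit_disk \<and>
     (\<forall>z\<in>unit_disk. wirtinger_zbar (wirtinger_z f) z = 0)"

definition canonical_decomposition ::
  "(complex \<Rightarrow> complex) \<Rightarrow> (complex \<Rightarrow> complex) \<Rightarrow> (complex \<Rightarrow> complex) \<Rightarrow> bool" where
  "canonical_decomposition f h g \<longleftrightarrow>
     h holomorphic_on unit_disk \<and> g holomorphic_on unit_disk \<and> g 0 = 0 \<and>
     (\<forall>z\<in>unit_disk. f z = h z + cnj (g z))"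

text \<open>The canonical decomposition determines both parts on the disk only. Outside the disk the
  choice is arbitrary, and all uses below are inside it; see
  \<open>deriv_canonical_parts\<close>.\<close>

definition analytic_part :: "(complex \<Rightarrow> complex) \<Rightarrow> complex \<Rightarrow> complex" where
  "analytic_part f = (SOME h. \<exists>g. canonical_decomposition f h g)"

definition coanalytic_part :: "(complex \<Rightarrow> complex) \<Rightarrow> complex \<Rightarrow> complex" where
  "coanalytic_part f = (SOME g. \<exists>h. canonical_decomposition f h g)"

definition jacobian :: "(complex \<Rightarrow> complex) \<Rightarrow> complex \<Rightarrow> real" where
  "jacobian f z = (cmod (deriv (analytic_part f) z))\<^sup>2 - (cmod (deriv (coanalytic_part f) z))\<^sup>2"

definition sense_preserving :: "(complex \<Rightarrow> complex) \<Rightarrow> bool" where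
  "sense_preserving f \<longleftrightarrow> (\<forall>z\<in>unit_disk. jacobian f z > 0)"

definition dilatation :: "(complex \<Rightarrow> complex) \<Rightarrow> complex \<Rightarrow> complex" where
  "dilatation f z = deriv (coanalytic_part f) z / deriv (analytic_part f) z"

text \<open>The supremum is taken in the reals, so it is meaningful only together with the boundedness
  clause in \<open>bloch_harmonic\<close>.\<close>

definition bloch_weight :: "real \<Rightarrow> (complex \<Rightarrow> complex) \<Rightarrow> complex \<Rightarrow> real" where
  "bloch_weight \<nu> f z = (1 - (cmod z)\<^sup>2) powr \<nu> * sqrt \<bar>jacobian f z\<bar>"

definition bloch_beta :: "real \<Rightarrow> (complex \<Rightarrow> complex) \<Rightarrow> real" where
  "bloch_beta \<nu> f = (SUP z\<in>unit_disk. bloch_weight \<nu> f z)"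

definition bloch_harmonic :: "real \<Rightarrow> (complex \<Rightarrow> complex) set" where
  "bloch_harmonic \<nu> = {f. harmonic_mapping f \<and> bdd_above (bloch_weight \<nu> f ` unit_disk)}"

definition bloch_norm :: "real \<Rightarrow> (complex \<Rightarrow> complex) \<Rightarrow> real" where
  "bloch_norm \<nu> f = cmod (f 0) + bloch_beta \<nu> f"

definition M_const :: "real \<Rightarrow> real" where
  "M_const p = max (2 powr (2 / p - 1)) 1"

text \<open>For \<open>m = 1\<close> the sum is empty and this is \<open>log (1 / (1 - r))\<close>; the
  value at \<open>m = 0\<close> is not used.\<close>

definition F_fun :: "nat \<Rightarrow> real \<Rightarrow> real" where
  "F_fun m r = 1 / real m * ln (1 / (1 - r)) +
     1 / real m * (\<Sum>n = 1..<m. 1 / real n * (1 / (1 - r) ^ n - 1))"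

definition radius1_eq :: "real \<Rightarrow> real \<Rightarrow> real \<Rightarrow> real \<Rightarrow> bool" where
  "radius1_eq \<nu> p w r \<longleftrightarrow>
     3 * (1 - w) * (1 - r\<^sup>2) powr (2 * \<nu> + 1) - M_const p * pi\<^sup>2 * (1 + w) * r\<^sup>2 = 0"

definition radius2_eq :: "nat \<Rightarrow> real \<Rightarrow> real \<Rightarrow> real \<Rightarrow> bool" where
  "radius2_eq k p w r \<longleftrightarrow>
     2 * M_const p * (1 + w) * r * F_fun (k + 1) r - (1 - w) * (1 - r) = 0"

definition radius1 :: "real \<Rightarrow> real \<Rightarrow> real \<Rightarrow> real" where
  "radius1 \<nu> p w = (THE r. r \<in> {0<..<1} \<and> radius1_eq \<nu> p w r)"

definition radius2 :: "nat \<Rightarrow> real \<Rightarrow> real \<Rightarrow> real" where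
  "radius2 k p w = (THE r. r \<in> {0<..<1} \<and> radius2_eq k p w r)"


lemma canonical_decomposition_has_derivative:
  assumes "canonical_decomposition f h g" "z \<in> unit_disk"
  shows "(f has_derivative (\<lambda>w. deriv h z * w + cnj (deriv g z * w))) (at z)"
proof -
  have "(h has_derivative (\<lambda>w. deriv h z * w)) (at z)" "(g has_derivative (\<lambda>w. deriv g z * w)) (at z)"
    using assms holomorphic_derivI[of _ unit_disk z UNIV]
    by (auto simp: canonical_decomposition_def has_field_derivative_def)
  then have "((\<lambda>x. h x + cnj (g x)) has_derivative (\<lambda>w. deriv h z * w + cnj (deriv g z * w))) (at z)"
    by (intro has_derivative_add has_derivative_cnj)
  then show ?thesis
    by (rule has_derivative_transform_within_open[where s = unit_disk])
       (use assms in \<open>auto simp: canonical_decomposition_def\<close>)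
qed

lemma wirtinger_canonical_decomposition:
  assumes "canonical_decomposition f h g" "z \<in> unit_disk"
  shows "wirtinger_z f z = deriv h z" "wirtinger_zbar f z = cnj (deriv g z)"
  using frechet_derivative_at[OF canonical_decomposition_has_derivative[OF assms], symmetric]
  by (simp_all add: wirtinger_z_def wirtinger_zbar_def algebra_simps)

lemma deriv_canonical_parts:
  assumes "canonical_decomposition f h g" "z \<in> unit_disk"
  shows "deriv (analytic_part f) z = deriv h z" "deriv (coanalytic_part f) z = deriv g z"
proof -
  have "\<exists>g. canonical_decomposition f (analytic_part f) g"
    unfolding analytic_part_def
    by (rule someI_ex[of "\<lambda>h. \<exists>g. canonical_decomposition f h g"]) (use assms in blast)
  moreover have "\<exists>h. canonical_decomposition f h (coanalytic_part f)"
    unfolding coanalytic_part_def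
    by (rule someI_ex[of "\<lambda>g. \<exists>h. canonical_decomposition f h g"]) (use assms in blast)
  ultimately show "deriv (analytic_part f) z = deriv h z" "deriv (coanalytic_part f) z = deriv g z"
    using wirtinger_canonical_decomposition assms by (metis complex_cnj_cancel_iff)+
qed

lemma jacobian_canonical:
  assumes "canonical_decomposition f h g" "z \<in> unit_disk"
  shows "jacobian f z = (cmod (deriv h z))\<^sup>2 - (cmod (deriv g z))\<^sup>2"
  by (simp add: jacobian_def deriv_canonical_parts[OF assms])

lemma dilatation_canonical:
  assumes "canonical_decomposition f h g" "z \<in> unit_disk"
  shows "dilatation f z = deriv g z / deriv h z"
  by (simp add: dilatation_def deriv_canonical_parts[OF assms])

lemma has_field_derivative_of_wirtinger:
  assumes "f differentiable (at z)" "wirtinger_zbar f z = 0"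
  shows "(f has_field_derivative wirtinger_z f z) (at z)"
proof -
  define L where "L = frechet_derivative f (at z)"
  have der: "(f has_derivative L) (at z)"
    using assms(1) unfolding L_def by (simp add: frechet_derivative_works[symmetric])
  then interpret L: bounded_linear L by (rule has_derivative_bounded_linear)
  have eq: "\<i> * L \<i> = - L 1"
    using assms(2) by (simp add: wirtinger_zbar_def L_def add_eq_0_iff)
  then have Li: "L \<i> = \<i> * L 1"
    by (metis complex_i_mult_minus mult_minus_right neg_equal_iff_equal)
  have "L w = wirtinger_z f z * w" for w
  proof -
    have "L w = L (Re w *\<^sub>R 1 + Im w *\<^sub>R \<i>)"
      by (rule arg_cong[where f = L]) (simp add: complex_eq_iff)
    also have "\<dots> = Re w *\<^sub>R L 1 + Im w *\<^sub>R L \<i>"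
      by (simp only: L.add L.scaleR)
    also have "\<dots> = L 1 * (of_real (Re w) + \<i> * of_real (Im w))"
      by (simp add: Li scaleR_conv_of_real algebra_simps)
    also have "\<dots> = L 1 * w"
      by (simp add: complex_eq[symmetric])
    also have "L 1 = wirtinger_z f z"
      using eq by (simp add: wirtinger_z_def L_def[symmetric])
    finally show ?thesis .
  qed
  then have "L = (\<lambda>w. wirtinger_z f z * w)" by blast
  then show ?thesis using der by (simp add: has_field_derivative_def)
qed

lemma harmonic_mapping_iff: "harmonic_mapping f \<longleftrightarrow> (\<exists>h g. canonical_decomposition f h g)"
proof
  assume harm: "harmonic_mapping f"
  have df: "f differentiable (at z)" and dfz: "wirtinger_z f differentiable (at z)"
    and zz: "wirtinger_zbar (wirtinger_z f) z = 0" if "z \<in> unit_disk" for z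
    using harm that by (auto simp: harmonic_mapping_def differentiable_on_eq_differentiable_at)
  have "wirtinger_z f holomorphic_on unit_disk"
    using has_field_derivative_of_wirtinger[OF dfz zz] holomorphic_on_open[OF open_ball] by blast
  then obtain h where h: "\<And>z. z \<in> unit_disk \<Longrightarrow> (h has_field_derivative wirtinger_z f z) (at z)"
    using holomorphic_convex_primitive'[of unit_disk "wirtinger_z f"]
    by (metis at_within_open convex_ball open_ball)
  define G where "G = (\<lambda>z. cnj (f z - h z))"
  have dG: "(G has_field_derivative cnj (wirtinger_zbar f z)) (at z)" if "z \<in> unit_disk" for z
  proof -
    let ?L = "\<lambda>w. cnj (frechet_derivative f (at z) w - wirtinger_z f z * w)"
    have "(G has_derivative ?L) (at z)"
      unfolding G_def
      using df[OF that] h[OF that]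
      by (intro has_derivative_cnj has_derivative_diff)
         (simp_all add: frechet_derivative_works has_field_derivative_def)
    then have fd: "frechet_derivative G (at z) = ?L" and dif: "G differentiable (at z)"
      using frechet_derivative_at by (metis, blast intro: differentiableI)
    have "wirtinger_zbar G z = 0"
      by (simp add: wirtinger_zbar_def fd) (simp add: wirtinger_z_def field_simps)
    moreover have "wirtinger_z G z = cnj (wirtinger_zbar f z)"
      by (simp add: wirtinger_z_def[of G] fd)
         (simp add: wirtinger_z_def wirtinger_zbar_def field_simps)
    ultimately show ?thesis
      using has_field_derivative_of_wirtinger[OF dif] by simp
  qed
  have "h holomorphic_on unit_disk" "G holomorphic_on unit_disk"
    using h dG holomorphic_on_open[OF open_ball] by blast+
  then have "canonical_decomposition f (\<lambda>z. h z + cnj (G 0)) (\<lambda>z. G z - G 0)"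
    by (auto simp: canonical_decomposition_def G_def intro!: holomorphic_intros)
  then show "\<exists>h g. canonical_decomposition f h g" by blast
next
  assume "\<exists>h g. canonical_decomposition f h g"
  then obtain h g where hg: "canonical_decomposition f h g" by blast
  have h': "deriv h holomorphic_on unit_disk"
    using hg by (auto simp: canonical_decomposition_def intro: holomorphic_deriv)
  have fz: "(wirtinger_z f has_derivative (\<lambda>w. deriv (deriv h) z * w)) (at z)"
    if "z \<in> unit_disk" for z
  proof (rule has_derivative_transform_within_open[where s = unit_disk])
    show "(deriv h has_derivative (\<lambda>w. deriv (deriv h) z * w)) (at z)"
      using holomorphic_derivI[OF h' open_ball that, of UNIV] by (simp add: has_field_derivative_def)
  qed (use that wirtinger_canonical_decomposition[OF hg] in auto)
  show "harmonic_mapping f"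
    unfolding harmonic_mapping_def differentiable_on_eq_differentiable_at[OF open_ball]
  proof (intro conjI ballI)
    fix z :: complex assume z: "z \<in> unit_disk"
    show "f differentiable (at z)"
      using canonical_decomposition_has_derivative[OF hg z] by (rule differentiableI)
    show "wirtinger_z f differentiable (at z)"
      using fz[OF z] by (rule differentiableI)
    show "wirtinger_zbar (wirtinger_z f) z = 0"
      using frechet_derivative_at[OF fz[OF z], symmetric]
      by (simp add: wirtinger_zbar_def[of "wirtinger_z f"] algebra_simps)
  qed
qed

end

theory Submission
  imports Defs
begin

text \<open>
  Write \<open>c\<^sub>n = (|a\<^sub>n|^p + |b\<^sub>n|^p)^(1/p)\<close> and \<open>w = |\<omega>(0)|\<close>, and let \<open>\<beta> \<le> 1 - |a\<^sub>0|\<close> be the supremum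
  of the weighted square root of the Jacobian \<open>J\<close>. Since \<open>J = |h'|\<^sup>2 (1 - |\<omega>|\<^sup>2)\<close>, the Schwarz-Pick
  lemma for \<open>\<omega>\<close> shows that \<open>|h'|\<^sup>2\<close>, hence also \<open>|g'|\<^sup>2\<close>, is at most
  \<open>\<beta>\<^sup>2 (1 + w) / (1 - w) (1 - |z|\<^sup>2)^(-2\<nu> - 1)\<close>. Averaging over circles and comparing the \<open>p\<close>-norm on
  the plane with the Euclidean one (this costs the factor \<open>M\<^sub>p\<close>) gives
  \<open>S(t) = \<Sum> n\<^sup>2 c\<^sub>n\<^sup>2 t^(n-1) \<le> C (1 - t)^(-2\<nu> - 1)\<close> with \<open>C = 2 M\<^sub>p \<beta>\<^sup>2 (1 + w) / (1 - w)\<close>.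

  The first radius comes from the Cauchy-Schwarz inequality with \<open>\<Sum> 1/n\<^sup>2 = \<pi>\<^sup>2/6\<close> and
  \<open>S(r\<^sup>2)\<close>. For the second one, \<open>2\<nu> + 1 \<le> k + 2\<close> and two integrations of the bound on \<open>S\<close>
  give \<open>\<Sum> c\<^sub>n\<^sup>2 r^n \<le> C F(r)\<close> with \<open>F\<close> of index \<open>k + 1\<close>; now apply the Cauchy-Schwarz
  inequality with \<open>\<Sum> r^n = r / (1 - r)\<close>.
\<close>

section \<open>Bessel's inequality for power series on circles\<close>

text \<open>Expand the squared moduli. For distinct n, m below N the number
  \<open>\<zeta> ^ n * cnj \<zeta> ^ m\<close> is an N-th root of unity other than 1, so its
  geometric sum over j vanishes and only the diagonal terms survive.\<close>

lemma sum_roots_parseval: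
  fixes d :: "nat \<Rightarrow> complex"
  assumes "N > 0"
  shows "(\<Sum>j<N. (cmod (\<Sum>n<N. d n * cis (2 * pi / N) ^ (j * n)))\<^sup>2) = N * (\<Sum>n<N. (cmod (d n))\<^sup>2)"
proof -
  define \<zeta> where "\<zeta> = cis (2 * pi / N)"
  have pw: "\<zeta> ^ N = 1" "\<zeta> * cnj \<zeta> = 1"
    using assms by (simp_all add: \<zeta>_def Complex.DeMoivre cis_cnj cis_mult)
  have inj: "inj_on (\<lambda>k. \<zeta> ^ k) {..<N}"
    using bij_betw_imp_inj_on[OF Complex.bij_betw_roots_unity[OF assms]]
    by (simp add: \<zeta>_def Complex.DeMoivre mult_ac inj_on_def)
  have orth: "(\<Sum>j<N. (\<zeta> ^ n * cnj \<zeta> ^ m) ^ j) = (if n = m then of_nat N else 0)"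
    if "n < N" "m < N" for n m
  proof (cases "n = m")
    case True
    then show ?thesis
      using pw by (simp flip: power_mult_distrib)
  next
    case False
    let ?x = "\<zeta> ^ n * cnj \<zeta> ^ m"
    have "?x \<noteq> 1"
    proof
      assume "?x = 1"
      then have "\<zeta> ^ m = \<zeta> ^ n * (\<zeta> * cnj \<zeta>) ^ m"
        by (simp add: power_mult_distrib mult_ac)
      then show False
        using False inj that pw by (auto simp: inj_on_def)
    qed
    moreover have "cnj \<zeta> ^ N = 1"
      using pw by (metis complex_cnj_one complex_cnj_power)
    then have "?x ^ N = 1"
      using pw by (simp add: power_mult_distrib flip: power_mult) (simp add: power_mult mult.commute[of _ N])
    ultimately show ?thesis
      using False by (simp add: geometric_sum)
  qed
  have "of_real (\<Sum>j<N. (cmod (\<Sum>n<N. d n * \<zeta> ^ (j * n)))\<^sup>2)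
     = (\<Sum>j<N. \<Sum>n<N. \<Sum>m<N. d n * cnj (d m) * (\<zeta> ^ n * cnj \<zeta> ^ m) ^ j)"
    by (simp only: of_real_sum complex_norm_square cnj_sum sum_product complex_cnj_mult complex_cnj_power)
       (simp add: power_mult_distrib mult_ac flip: power_mult)
  also have "\<dots> = (\<Sum>n<N. \<Sum>j<N. \<Sum>m<N. d n * cnj (d m) * (\<zeta> ^ n * cnj \<zeta> ^ m) ^ j)"
    by (rule sum.swap)
  also have "\<dots> = (\<Sum>n<N. \<Sum>m<N. \<Sum>j<N. d n * cnj (d m) * (\<zeta> ^ n * cnj \<zeta> ^ m) ^ j)"
    by (intro sum.cong refl sum.swap)
  also have "\<dots> = (\<Sum>n<N. \<Sum>m<N. d n * cnj (d m) * (if n = m then of_nat N else 0))"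
    by (intro sum.cong refl) (simp add: orth flip: sum_distrib_left)
  also have "\<dots> = (\<Sum>n<N. d n * cnj (d n) * of_nat N)"
    by (intro sum.cong refl) (simp add: if_distrib cong: if_cong)
  also have "\<dots> = of_real (N * (\<Sum>n<N. (cmod (d n))\<^sup>2))"
    by (simp add: sum_distrib_left mult_ac complex_norm_square flip: of_real_power)
  finally show ?thesis
    unfolding \<zeta>_def using of_real_eq_iff by blast
qed

text \<open>The mean over the circle is replaced by the mean over the \<open>N\<close>-th roots of unity, for which
  the polynomial of the first \<open>N\<close> terms satisfies an exact Parseval identity; the tail vanishes as
  \<open>N\<close> grows.\<close>

lemma powser_circle_bessel:
  fixes c :: "nat \<Rightarrow> complex"
  assumes sums: "\<And>z. cmod z < 1 \<Longrightarrow> (\<lambda>n. c n * z ^ n) sums F z"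
    and r: "0 \<le> r" "r < 1" and bound: "\<And>z. cmod z = r \<Longrightarrow> cmod (F z) \<le> B"
  shows "(\<Sum>n<M. (cmod (c n) * r ^ n)\<^sup>2) \<le> B\<^sup>2"
proof -
  have summ: "summable (\<lambda>n. cmod (c n) * r ^ n)"
  proof -
    \<comment> \<open>Convergence at the midpoint between r and 1 yields absolute convergence at
      r.\<close>
    have "cmod (of_real ((1 + r) / 2)) < 1"
      using r by (subst norm_of_real) auto
    from powser_insidea[OF sums_summable[OF sums[OF this]], of "of_real r"] r show ?thesis
      by (simp only: norm_of_real norm_mult norm_power) simp
  qed
  define E where "E N = (\<Sum>n. cmod (c (n + N)) * r ^ (n + N))" for N
  have "E \<longlonglongrightarrow> 0"
    unfolding E_def using suminf_exist_split2[OF summ] .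
  then have lim: "(\<lambda>N. (B + E N)\<^sup>2) \<longlonglongrightarrow> (B + 0)\<^sup>2"
    by (intro tendsto_intros)
  \<comment> \<open>\<open>N \<ge> Suc M\<close> serves twice: N is positive, as Parseval requires,
    and the sum up to M is part of the sum up to N.\<close>
  have "(\<Sum>n<M. (cmod (c n) * r ^ n)\<^sup>2) \<le> (B + E N)\<^sup>2" if N: "N \<ge> Suc M" for N
  proof -
    \<comment> \<open>This is the N-th partial sum of the series at a point z of the circle, so it
      differs from F z by at most the tail \<open>E N\<close>.\<close>
    have "cmod (\<Sum>n<N. c n * r ^ n * cis (2 * pi / N) ^ (j * n)) \<le> B + E N" for j
    proof -
      define z where "z = r * cis (2 * pi / N) ^ j"
      have z: "cmod z = r"
        using r by (simp add: z_def norm_mult norm_power)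
      have s: "(\<lambda>n. c n * z ^ n) sums F z"
        using sums z r by simp
      have "cmod (\<Sum>n. c (n + N) * z ^ (n + N)) \<le> E N"
        unfolding E_def
        using summable_norm[of "\<lambda>n. c (n + N) * z ^ (n + N)"] summable_ignore_initial_segment[OF summ, of N]
        by (simp add: norm_mult norm_power z)
      moreover have "F z = (\<Sum>n. c (n + N) * z ^ (n + N)) + (\<Sum>n<N. c n * z ^ n)"
        using suminf_split_initial_segment[OF sums_summable[OF s], of N] sums_unique[OF s] by simp
      then have "cmod (\<Sum>n<N. c n * z ^ n) \<le> cmod (F z) + cmod (\<Sum>n. c (n + N) * z ^ (n + N))"
        by (metis add_diff_cancel_left' norm_triangle_ineq4)
      moreover have "(\<Sum>n<N. c n * r ^ n * cis (2 * pi / N) ^ (j * n)) = (\<Sum>n<N. c n * z ^ n)"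
        by (simp add: z_def power_mult_distrib mult_ac flip: power_mult)
      ultimately show ?thesis
        using bound[OF z] by simp
    qed
    then have "(\<Sum>j<N. (cmod (\<Sum>n<N. c n * r ^ n * cis (2 * pi / N) ^ (j * n)))\<^sup>2) \<le> (\<Sum>j<N. (B + E N)\<^sup>2)"
      by (intro sum_mono power_mono) auto
    then have "N * (\<Sum>n<N. (cmod (c n * r ^ n))\<^sup>2) \<le> N * (B + E N)\<^sup>2"
      using sum_roots_parseval[of N "\<lambda>n. c n * r ^ n"] N by simp
    then have "(\<Sum>n<N. (cmod (c n) * r ^ n)\<^sup>2) \<le> (B + E N)\<^sup>2"
      using N r by (simp add: norm_mult norm_power)
    moreover have "(\<Sum>n<M. (cmod (c n) * r ^ n)\<^sup>2) \<le> (\<Sum>n<N. (cmod (c n) * r ^ n)\<^sup>2)"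
      using N by (intro sum_mono2) auto
    ultimately show ?thesis by linarith
  qed
  then have "(\<Sum>n<M. (cmod (c n) * r ^ n)\<^sup>2) \<le> (B + 0)\<^sup>2"
    by (intro LIMSEQ_le_const[OF lim]) blast
  then show ?thesis by simp
qed

section \<open>A Schwarz-Pick estimate relative to the origin\<close>

text \<open>Compose \<open>\<omega>\<close> with the disk automorphism that sends u =
  \<open>\<omega> 0\<close> to 0 and apply the Schwarz lemma: |v - u| <= |z| |D|. The identity |D|^2
  - |v - u|^2 = (1 - |u|^2)(1 - |v|^2) and |D| >= 1 - |u| then give the claim after cancelling a
  factor 1 - |u|.\<close>

lemma Schwarz_Pick_norm:
  assumes hol: "\<omega> holomorphic_on ball 0 1" and lt: "\<And>z. cmod z < 1 \<Longrightarrow> cmod (\<omega> z) < 1"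
    and z: "cmod z < 1"
  shows "(1 - cmod (\<omega> 0)) * (1 - (cmod z)\<^sup>2) \<le> (1 + cmod (\<omega> 0)) * (1 - (cmod (\<omega> z))\<^sup>2)"
proof -
  define u where "u = \<omega> 0"
  define v where "v = \<omega> z"
  define D where "D = 1 - cnj u * v"
  have u: "cmod u < 1" and v: "cmod v < 1"
    using lt[of 0] lt[OF z] by (simp_all add: u_def v_def)
  have "\<omega> ` ball 0 1 \<subseteq> ball 0 1"
    using lt by auto
  then have "(\<lambda>x. Moebius_function 0 u (\<omega> x)) holomorphic_on ball 0 1"
    using holomorphic_on_compose_gen[OF hol Moebius_function_holomorphic[OF u, of 0]]
    by (simp add: o_def)
  moreover have "cmod (Moebius_function 0 u (\<omega> x)) < 1" if "cmod x < 1" for x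
    using Moebius_function_norm_lt_1[OF u lt[OF that]] .
  ultimately have "cmod (Moebius_function 0 u v) \<le> cmod z"
    unfolding v_def
    using z by (intro Schwarz_Lemma(1)) (simp_all add: u_def Moebius_function_eq_zero)
  moreover have D: "cmod D \<ge> 1 - cmod u"
    using norm_triangle_ineq2[of 1 "cnj u * v"] u v mult_left_mono[of "cmod v" 1 "cmod u"]
    by (simp add: D_def norm_mult)
  ultimately have "cmod (v - u) \<le> cmod z * cmod D"
    using u by (auto simp: Moebius_function_simple D_def[symmetric] norm_divide divide_le_eq split: if_splits)
  then have "(cmod (v - u))\<^sup>2 \<le> (cmod z * cmod D)\<^sup>2"
    by (intro power_mono) auto
  moreover have "(cmod D)\<^sup>2 - (cmod (v - u))\<^sup>2 = (1 - (cmod u)\<^sup>2) * (1 - (cmod v)\<^sup>2)"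
    by (simp only: D_def cmod_power2) (simp add: power2_eq_square algebra_simps)
  ultimately have "(cmod D)\<^sup>2 * (1 - (cmod z)\<^sup>2) \<le> (1 - (cmod u)\<^sup>2) * (1 - (cmod v)\<^sup>2)"
    by (simp add: algebra_simps power_mult_distrib)
  moreover have "(1 - cmod u)\<^sup>2 * (1 - (cmod z)\<^sup>2) \<le> (cmod D)\<^sup>2 * (1 - (cmod z)\<^sup>2)"
    using D u z by (intro mult_right_mono power_mono) (auto simp: abs_square_le_1)
  ultimately have "(1 - cmod u) * ((1 - cmod u) * (1 - (cmod z)\<^sup>2)) \<le> (1 - cmod u) * ((1 + cmod u) * (1 - (cmod v)\<^sup>2))"
    by (simp add: power2_eq_square algebra_simps)
  then show ?thesis
    using u by (simp add: u_def v_def)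
qed

section \<open>The p-norm and the Euclidean norm on the plane\<close>

text \<open>The fractions x / (x + y) and y / (x + y) lie in [0,1], where raising to a power s >= 1
  does not increase; they add up to 1.\<close>

lemma powr_sum_superadditive:
  fixes x y s :: real
  assumes "s \<ge> 1" "x \<ge> 0" "y \<ge> 0"
  shows "x powr s + y powr s \<le> (x + y) powr s"
proof (cases "x + y = 0")
  case False
  then have T: "x + y > 0" using assms by simp
  have *: "u powr s \<le> u / (x + y) * (x + y) powr s" if "0 \<le> u" "u \<le> x + y" for u
  proof -
    have "(u / (x + y)) powr s \<le> (u / (x + y)) powr 1"
      using that T assms by (intro powr_mono') auto
    then have "u powr s / (x + y) powr s \<le> u / (x + y)"
      using that T by (simp add: powr_divide)
    then show ?thesis using T by (simp add: divide_le_eq)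
  qed
  have "x powr s + y powr s \<le> (x / (x + y) + y / (x + y)) * (x + y) powr s"
    using *[of x] *[of y] assms by (simp add: distrib_right)
  also have "x / (x + y) + y / (x + y) = 1"
    using T by (simp flip: add_divide_distrib)
  finally show ?thesis by simp
next
  case True
  then have "x = 0" "y = 0" using assms by auto
  then show ?thesis by simp
qed

text \<open>Midpoint convexity of the power function; a zero argument is treated directly.\<close>

lemma powr_add_convex_bound:
  fixes x y q :: real
  assumes "q \<ge> 1" "x \<ge> 0" "y \<ge> 0"
  shows "(x + y) powr q \<le> 2 powr (q - 1) * (x powr q + y powr q)"
proof (cases "x = 0 \<or> y = 0")
  case True
  have "1 \<le> 2 powr (q - 1)" using assms by (simp add: ge_one_powr_ge_zero)
  then have "z powr q \<le> 2 powr (q - 1) * z powr q" for z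
    by (simp add: mult_le_cancel_right1)
  then show ?thesis using True by auto
next
  case False
  then have "((1 - 1/2) *\<^sub>R x + (1/2) *\<^sub>R y) powr q \<le> (1 - 1/2) * x powr q + (1/2) * y powr q"
    using assms by (intro convex_onD[OF powr_convex]) auto
  then have "((x + y) / 2) powr q \<le> (x powr q + y powr q) / 2"
    by (simp add: add_divide_distrib)
  then have "(x + y) powr q / 2 powr q \<le> (x powr q + y powr q) / 2"
    using assms by (simp add: powr_divide)
  then show ?thesis by (simp add: powr_diff field_simps)
qed

text \<open>For p <= 2 the exponent 2/p is at least 1 and convexity costs 2^(2/p - 1). For p > 2
  superadditivity with exponent p/2 shows that the p-norm is at most the Euclidean norm.
  \<open>M_const p\<close> covers both cases.\<close>

lemma lp_norm_le_M_const:
  fixes x y p :: real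
  assumes "p \<ge> 1" "x \<ge> 0" "y \<ge> 0"
  shows "((x powr p + y powr p) powr (1 / p))\<^sup>2 \<le> M_const p * (x\<^sup>2 + y\<^sup>2)"
proof -
  have sq: "((x powr p + y powr p) powr (1 / p))\<^sup>2 = (x powr p + y powr p) powr (2 / p)"
    by (simp add: powr_powr flip: powr_numeral)
  have M: "2 powr (2 / p - 1) \<le> M_const p" "1 \<le> M_const p"
    by (auto simp: M_const_def)
  show ?thesis
  proof (cases "p \<le> 2")
    case True
    have "(x powr p + y powr p) powr (2 / p) \<le>
        2 powr (2 / p - 1) * ((x powr p) powr (2 / p) + (y powr p) powr (2 / p))"
      using assms True by (intro powr_add_convex_bound) auto
    also have "\<dots> = 2 powr (2 / p - 1) * (x\<^sup>2 + y\<^sup>2)"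
      using assms by (simp add: powr_powr)
    also have "\<dots> \<le> M_const p * (x\<^sup>2 + y\<^sup>2)"
      using M by (intro mult_right_mono) auto
    finally show ?thesis by (simp only: sq)
  next
    case False
    have "x powr p + y powr p = (x\<^sup>2) powr (p / 2) + (y\<^sup>2) powr (p / 2)"
      using assms by (simp add: powr_powr flip: powr_numeral)
    also have "\<dots> \<le> (x\<^sup>2 + y\<^sup>2) powr (p / 2)"
      using False by (intro powr_sum_superadditive) auto
    finally have "(x powr p + y powr p) powr (2 / p) \<le> ((x\<^sup>2 + y\<^sup>2) powr (p / 2)) powr (2 / p)"
      using assms by (intro powr_mono2) auto
    also have "\<dots> = x\<^sup>2 + y\<^sup>2"
      using assms by (simp add: powr_powr)
    also have "\<dots> \<le> M_const p * (x\<^sup>2 + y\<^sup>2)"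
      using M mult_right_mono[of 1 "M_const p" "x\<^sup>2 + y\<^sup>2"] by simp
    finally show ?thesis by (simp only: sq)
  qed
qed

section \<open>Calculus of the functions F_m\<close>

lemma inverse_power_has_derivative:
  fixes t :: real
  assumes "t < 1"
  shows "((\<lambda>r. 1 / (1 - r) ^ n - 1) has_real_derivative n / (1 - t) ^ Suc n) (at t)"
proof -
  have "((\<lambda>r. inverse (1 - r)) has_real_derivative 1 / (1 - t)\<^sup>2) (at t)"
    using assms by (auto intro!: derivative_eq_intros simp: power2_eq_square field_simps)
  then have der: "((\<lambda>r. inverse (1 - r) ^ n - 1) has_real_derivative
      n * (1 / (1 - t)\<^sup>2 * inverse (1 - t) ^ (n - Suc 0)) - 0) (at t)"
    by (intro DERIV_diff DERIV_power DERIV_const)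
  \<comment> \<open>The power rule leaves the truncated exponent \<open>n - Suc 0\<close>; for n = 0
    both sides vanish because of the factor n.\<close>
  have eq: "n * (1 / (1 - t)\<^sup>2 * inverse (1 - t) ^ (n - Suc 0)) - 0 = n / (1 - t) ^ Suc n"
    using assms by (cases n) (auto simp: power2_eq_square field_simps)
  have "(\<lambda>r::real. inverse (1 - r) ^ n - 1) = (\<lambda>r. 1 / (1 - r) ^ n - 1)"
    by (simp add: inverse_eq_divide power_one_over)
  with der show ?thesis
    unfolding eq by simp
qed

text \<open>The logarithm contributes the exponent 1 and the summand of index n the exponent n + 1,
  so the derivative is the mean of the first m inverse powers of 1 - t.\<close>

lemma F_fun_has_derivative:
  assumes "t < 1" "m \<ge> 1"
  shows "(F_fun m has_real_derivative (\<Sum>n=1..m. 1 / (1 - t) ^ n) / m) (at t)"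
proof -
  have "((\<lambda>r. 1 / (1 - r)) has_real_derivative 1 / (1 - t)\<^sup>2) (at t)"
    using assms by (auto intro!: derivative_eq_intros simp: power2_eq_square)
  from DERIV_chain2[OF DERIV_ln this]
  have "((\<lambda>r. ln (1 / (1 - r))) has_real_derivative 1 / (1 - t)) (at t)"
    using assms by (simp add: power2_eq_square)
  moreover have "((\<lambda>r. \<Sum>n=1..<m. 1 / real n * (1 / (1 - r) ^ n - 1)) has_real_derivative
      (\<Sum>n=1..<m. 1 / (1 - t) ^ Suc n)) (at t)"
  proof (rule DERIV_sum)
    fix n assume n: "n \<in> {1..<m}"
    have "((\<lambda>r. 1 / real n * (1 / (1 - r) ^ n - 1)) has_real_derivative 1 / real n * (n / (1 - t) ^ Suc n)) (at t)"
      using assms by (intro DERIV_cmult inverse_power_has_derivative)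
    then show "((\<lambda>r. 1 / real n * (1 / (1 - r) ^ n - 1)) has_real_derivative 1 / (1 - t) ^ Suc n) (at t)"
      using n by simp
  qed
  ultimately have "((\<lambda>r. 1 / real m * ln (1 / (1 - r)) + 1 / real m * (\<Sum>n=1..<m. 1 / real n * (1 / (1 - r) ^ n - 1)))
      has_real_derivative 1 / real m * (1 / (1 - t)) + 1 / real m * (\<Sum>n=1..<m. 1 / (1 - t) ^ Suc n)) (at t)"
    by (intro DERIV_add DERIV_cmult)
  moreover have "1 / (1 - t) + (\<Sum>n=1..<m. 1 / (1 - t) ^ Suc n) = (\<Sum>n=1..m. 1 / (1 - t) ^ n)"
    using assms(2) by (induction m rule: dec_induct) (auto simp: sum.atLeastLessThan_Suc)
  then have "1 / real m * (1 / (1 - t)) + 1 / real m * (\<Sum>n=1..<m. 1 / (1 - t) ^ Suc n)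
     = (\<Sum>n=1..m. 1 / (1 - t) ^ n) / m"
    by (simp only: distrib_left[symmetric]) simp
  ultimately show ?thesis
    by (simp add: F_fun_def[abs_def])
qed

text \<open>A telescoping sum. It recognises the once integrated bound as t times a multiple of the
  derivative of \<open>F_fun m\<close>.\<close>

lemma mult_sum_inverse_powers:
  fixes t :: real
  assumes "t < 1"
  shows "t * (\<Sum>n=1..m. 1 / (1 - t) ^ n) = 1 / (1 - t) ^ m - 1"
proof (induction m)
  case (Suc m)
  have "t / (1 - t) ^ Suc m = 1 / (1 - t) ^ Suc m - 1 / (1 - t) ^ m"
    using assms by (simp add: field_simps)
  then show ?case
    using Suc by (simp add: distrib_left)
qed simp

lemma F_fun_0 [simp]: "F_fun m 0 = 0"
  by (simp add: F_fun_def)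

lemma F_fun_continuous_on:
  assumes "m \<ge> 1" "S \<subseteq> {..<1}"
  shows "continuous_on S (F_fun m)"
  using F_fun_has_derivative assms
  by (intro continuous_at_imp_continuous_on ballI) (blast intro: DERIV_isCont)

text \<open>The derivative of \<open>F_fun m\<close> is a mean of terms that are at least 1. This
  one estimate supplies monotonicity, nonnegativity (s = 0) and the lower bound t.\<close>

lemma F_fun_diff_ge:
  assumes "0 \<le> s" "s \<le> t" "t < 1" "m \<ge> 1"
  shows "t - s \<le> F_fun m t - F_fun m s"
proof -
  have "F_fun m s - s \<le> F_fun m t - t"
  proof (rule DERIV_nonneg_imp_nondecreasing[OF \<open>s \<le> t\<close>])
    fix x assume x: "s \<le> x" "x \<le> t"
    have "1 \<le> 1 / (1 - x) ^ n" for n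
      using x assms by (simp add: power_le_one)
    then have "real m \<le> (\<Sum>n=1..m. 1 / (1 - x) ^ n)"
      using sum_mono[of "{1..m}" "\<lambda>_. 1" "\<lambda>n. 1 / (1 - x) ^ n"] by simp
    then have "0 \<le> (\<Sum>n=1..m. 1 / (1 - x) ^ n) / m - 1"
      using assms by simp
    moreover have "((\<lambda>x. F_fun m x - x) has_real_derivative (\<Sum>n=1..m. 1 / (1 - x) ^ n) / m - 1) (at x)"
      using F_fun_has_derivative[of x m] x assms by (intro DERIV_diff DERIV_ident) auto
    ultimately show "\<exists>y. ((\<lambda>x. F_fun m x - x) has_real_derivative y) (at x) \<and> 0 \<le> y"
      by blast
  qed
  then show ?thesis by simp
qed

text \<open>Here \<open>c n\<close> stands for the coefficient of index \<open>n + 1\<close>. Integrating the bound once gives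
  a bound for \<open>t * Q t\<close> that is \<open>C * t\<close> times the derivative of \<open>F_fun m\<close>; dividing by \<open>t\<close>
  and integrating again gives the claim.\<close>

lemma sum_power_le_F_fun:
  fixes c :: "nat \<Rightarrow> real"
  assumes bound: "\<And>t. 0 \<le> t \<Longrightarrow> t < 1 \<Longrightarrow> (\<Sum>n<N. (Suc n * c n)\<^sup>2 * t ^ n) \<le> C / (1 - t) ^ Suc m"
    and "m \<ge> 1" and r: "0 \<le> r" "r < 1"
  shows "(\<Sum>n<N. (c n)\<^sup>2 * r ^ Suc n) \<le> C * F_fun m r"
proof -
  define Q where "Q t = (\<Sum>n<N. Suc n * (c n)\<^sup>2 * t ^ n)" for t
  have Q: "t * Q t \<le> C * (1 / (1 - t) ^ m - 1) / m" if t: "0 \<le> t" "t < 1" for t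
  proof -
    let ?f = "\<lambda>t. C * (1 / (1 - t) ^ m - 1) / m - (\<Sum>n<N. Suc n * (c n)\<^sup>2 * t ^ Suc n)"
    have "?f 0 \<le> ?f t"
    proof (rule DERIV_nonneg_imp_nondecreasing[OF t(1)])
      fix x assume x: "0 \<le> x" "x \<le> t"
      have "((\<lambda>t. C / m * (1 / (1 - t) ^ m - 1)) has_real_derivative C / m * (m / (1 - x) ^ Suc m)) (at x)"
        using inverse_power_has_derivative[of x m] x t by (intro DERIV_cmult) auto
      then have "((\<lambda>t. C * (1 / (1 - t) ^ m - 1) / m) has_real_derivative C / (1 - x) ^ Suc m) (at x)"
        using \<open>m \<ge> 1\<close> by simp
      moreover have "((\<lambda>t. \<Sum>n<N. Suc n * (c n)\<^sup>2 * t ^ Suc n) has_real_derivative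
          (\<Sum>n<N. (Suc n * c n)\<^sup>2 * x ^ n)) (at x)"
      proof (rule DERIV_sum)
        fix n
        show "((\<lambda>t. Suc n * (c n)\<^sup>2 * t ^ Suc n) has_real_derivative (Suc n * c n)\<^sup>2 * x ^ n) (at x)"
          using DERIV_cmult[OF DERIV_pow[of "Suc n" x], of "Suc n * (c n)\<^sup>2"]
          by (simp add: power2_eq_square mult_ac del: of_nat_Suc)
      qed
      ultimately have "(?f has_real_derivative C / (1 - x) ^ Suc m - (\<Sum>n<N. (Suc n * c n)\<^sup>2 * x ^ n)) (at x)"
        by (rule DERIV_diff)
      moreover have "0 \<le> C / (1 - x) ^ Suc m - (\<Sum>n<N. (Suc n * c n)\<^sup>2 * x ^ n)"
        using bound[of x] x t by simp
      ultimately show "\<exists>y. (?f has_real_derivative y) (at x) \<and> 0 \<le> y"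
        by blast
    qed
    then show ?thesis
      by (simp add: Q_def sum_distrib_left mult_ac)
  qed
  let ?g = "\<lambda>t. C * F_fun m t - (\<Sum>n<N. (c n)\<^sup>2 * t ^ Suc n)"
  \<comment> \<open>Dividing by x requires x > 0, so the derivative is examined on the open interval
    and continuity takes care of the endpoints.\<close>
  have "?g 0 \<le> ?g r"
  proof (rule DERIV_nonneg_imp_increasing_open[OF r(1)])
    fix x assume x: "0 < x" "x < r"
    let ?G = "(\<Sum>n=1..m. 1 / (1 - x) ^ n) / m"
    have "((\<lambda>t. \<Sum>n<N. (c n)\<^sup>2 * t ^ Suc n) has_real_derivative Q x) (at x)"
      unfolding Q_def
    proof (rule DERIV_sum)
      fix n
      show "((\<lambda>t. (c n)\<^sup>2 * t ^ Suc n) has_real_derivative Suc n * (c n)\<^sup>2 * x ^ n) (at x)"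
        using DERIV_cmult[OF DERIV_pow[of "Suc n" x], of "(c n)\<^sup>2"]
        by (simp add: mult_ac del: of_nat_Suc)
    qed
    moreover have "((\<lambda>t. C * F_fun m t) has_real_derivative C * ?G) (at x)"
      using F_fun_has_derivative[of x m] x r \<open>m \<ge> 1\<close> by (intro DERIV_cmult) auto
    ultimately have "(?g has_real_derivative C * ?G - Q x) (at x)"
      by (intro DERIV_diff)
    moreover have "x * Q x \<le> x * (C * ?G)"
      using Q[of x] mult_sum_inverse_powers[of x m] x r by (simp add: mult.left_commute)
    then have "0 \<le> C * ?G - Q x"
      using x by (simp only: mult_le_cancel_left_pos diff_ge_0_iff_ge)
    ultimately show "\<exists>y. (?g has_real_derivative y) (at x) \<and> 0 \<le> y"
      by blast
  next
    show "continuous_on {0..r} ?g"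
      using r \<open>m \<ge> 1\<close> by (intro continuous_intros F_fun_continuous_on) auto
  qed
  then show ?thesis by simp
qed

section \<open>Two Cauchy-Schwarz estimates\<close>

text \<open>Each term is split as ((n+1) c_n r^n) (r/(n+1)), which pairs the derivative coefficients
  with the Basel series.\<close>

lemma partial_sum_sq_le_inverse_squares:
  fixes c :: "nat \<Rightarrow> real"
  assumes "0 \<le> r"
  shows "(\<Sum>n<N. c n * r ^ Suc n)\<^sup>2 \<le> (\<Sum>n<N. (Suc n * c n)\<^sup>2 * (r\<^sup>2) ^ n) * (r\<^sup>2 * pi\<^sup>2 / 6)"
proof -
  have "(\<Sum>n<N. c n * r ^ Suc n)\<^sup>2 = (\<Sum>n<N. (Suc n * c n * r ^ n) * (r / Suc n))\<^sup>2"
    by (intro arg_cong[where f = "\<lambda>x. x\<^sup>2"] sum.cong refl) (simp add: mult_ac del: of_nat_Suc)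
  also have "\<dots> \<le> (\<Sum>n<N. (Suc n * c n * r ^ n)\<^sup>2) * (\<Sum>n<N. (r / Suc n)\<^sup>2)"
    by (rule Cauchy_Schwarz_ineq_sum)
  also have "\<dots> \<le> (\<Sum>n<N. (Suc n * c n * r ^ n)\<^sup>2) * (r\<^sup>2 * (pi\<^sup>2 / 6))"
  proof (intro mult_left_mono sum_nonneg zero_le_power2)
    have basel: "(\<lambda>n. 1 / (real n + 1)\<^sup>2) sums (pi\<^sup>2 / 6)"
      using inverse_squares_sums by (simp add: add.commute)
    have "(\<Sum>n<N. (r / Suc n)\<^sup>2) = r\<^sup>2 * (\<Sum>n<N. 1 / (real n + 1)\<^sup>2)"
      by (simp add: power_divide sum_distrib_left add.commute)
    also have "\<dots> \<le> r\<^sup>2 * (\<Sum>n. 1 / (real n + 1)\<^sup>2)"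
      by (intro mult_left_mono sum_le_suminf sums_summable[OF basel]) auto
    also have "\<dots> = r\<^sup>2 * (pi\<^sup>2 / 6)"
      by (simp only: sums_unique[OF basel, symmetric])
    finally show "(\<Sum>n<N. (r / Suc n)\<^sup>2) \<le> r\<^sup>2 * (pi\<^sup>2 / 6)" .
  qed
  finally show ?thesis
    by (simp add: power_mult_distrib mult_ac flip: power_mult)
qed

text \<open>Each power of r is split evenly between the two factors by means of q = sqrt r; the
  second factor is then a geometric sum.\<close>

lemma partial_sum_sq_le_geometric:
  fixes c :: "nat \<Rightarrow> real"
  assumes "0 \<le> r" "r < 1"
  shows "(\<Sum>n<N. c n * r ^ Suc n)\<^sup>2 \<le> (\<Sum>n<N. (c n)\<^sup>2 * r ^ Suc n) * (r / (1 - r))"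
proof -
  define q where "q = sqrt r"
  have q: "r = q\<^sup>2" using assms by (simp add: q_def)
  have "(\<Sum>n<N. c n * r ^ Suc n)\<^sup>2 = (\<Sum>n<N. (c n * q ^ Suc n) * q ^ Suc n)\<^sup>2"
    by (simp add: q power2_eq_square power_mult_distrib mult_ac)
  also have "\<dots> \<le> (\<Sum>n<N. (c n * q ^ Suc n)\<^sup>2) * (\<Sum>n<N. (q ^ Suc n)\<^sup>2)"
    by (rule Cauchy_Schwarz_ineq_sum)
  also have "\<dots> = (\<Sum>n<N. (c n)\<^sup>2 * r ^ Suc n) * (\<Sum>n<N. r ^ Suc n)"
    by (simp add: q power_mult_distrib power2_eq_square mult_ac)
  also have "\<dots> \<le> (\<Sum>n<N. (c n)\<^sup>2 * r ^ Suc n) * (r / (1 - r))"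
  proof (intro mult_left_mono sum_nonneg)
    have "(\<Sum>n<N. r ^ Suc n) = r * ((1 - r ^ N) / (1 - r))"
      using assms by (simp add: geometric_sum sum_distrib_left[symmetric]) (simp add: field_simps)
    also have "\<dots> \<le> r * (1 / (1 - r))"
      using assms by (intro mult_left_mono divide_right_mono) auto
    finally show "(\<Sum>n<N. r ^ Suc n) \<le> r / (1 - r)" by simp
  qed (use assms in auto)
  finally show ?thesis .
qed

section \<open>Existence and uniqueness of the two radii\<close>

text \<open>The sign change is sought on [0,c] instead of [0,1] because the second radius equation
  involves functions that blow up at 1.\<close>

lemma ex1_root_of_strict_mono:
  fixes f :: "real \<Rightarrow> real"
  assumes "0 < c" "c \<le> 1" and cont: "continuous_on {0..c} f" and "f 0 < 0" "0 < f c"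
    and mono: "strict_mono_on {0..<1} f"
  shows "\<exists>!r. r \<in> {0<..<1} \<and> f r = 0"
proof -
  obtain r where r: "0 \<le> r" "r \<le> c" "f r = 0"
    using IVT'[of f 0 0 c] assms by force
  then have "r \<noteq> 0" "r \<noteq> c" using assms by auto
  then have r01: "r \<in> {0<..<1}" using r \<open>c \<le> 1\<close> by auto
  show ?thesis
  proof (rule ex1I)
    show "r \<in> {0<..<1} \<and> f r = 0" using r01 r by blast
  next
    fix s assume s: "s \<in> {0<..<1} \<and> f s = 0"
    then have "s \<in> {0..<1}" "r \<in> {0..<1}" using r01 by auto
    then show "s = r"
      using inj_onD[OF strict_mono_on_imp_inj_on[OF mono], of s r] s r by simp
  qed
qed

lemma M_const_ge_1: "1 \<le> M_const p"
  by (simp add: M_const_def)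

lemma radius1_fun_strict_mono:
  assumes "\<nu> > 0" "0 \<le> w" "w < 1"
  shows "strict_mono_on {0..<1} (\<lambda>r. M_const p * pi\<^sup>2 * (1 + w) * r\<^sup>2 - 3 * (1 - w) * (1 - r\<^sup>2) powr (2 * \<nu> + 1))"
proof (rule strict_mono_onI)
  fix r s :: real assume rs: "r \<in> {0..<1}" "s \<in> {0..<1}" "r < s"
  then have sq: "r\<^sup>2 < s\<^sup>2" "s\<^sup>2 < 1"
    by (auto intro: power_strict_mono simp: power_less_one_iff)
  have "(1 - s\<^sup>2) powr (2 * \<nu> + 1) < (1 - r\<^sup>2) powr (2 * \<nu> + 1)"
    using sq assms by (intro powr_less_mono2) auto
  then have "3 * (1 - w) * (1 - s\<^sup>2) powr (2 * \<nu> + 1) < 3 * (1 - w) * (1 - r\<^sup>2) powr (2 * \<nu> + 1)"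
    using assms by (intro mult_strict_left_mono) auto
  moreover have "M_const p * pi\<^sup>2 * (1 + w) * r\<^sup>2 \<le> M_const p * pi\<^sup>2 * (1 + w) * s\<^sup>2"
    using sq assms M_const_ge_1[of p] by (intro mult_left_mono mult_nonneg_nonneg) auto
  ultimately show "M_const p * pi\<^sup>2 * (1 + w) * r\<^sup>2 - 3 * (1 - w) * (1 - r\<^sup>2) powr (2 * \<nu> + 1)
     < M_const p * pi\<^sup>2 * (1 + w) * s\<^sup>2 - 3 * (1 - w) * (1 - s\<^sup>2) powr (2 * \<nu> + 1)"
    by linarith
qed

lemma radius1_ex1:
  assumes "\<nu> > 0" "0 \<le> w" "w < 1"
  shows "\<exists>!r. r \<in> {0<..<1} \<and> radius1_eq \<nu> p w r"
proof -
  let ?f = "\<lambda>r. M_const p * pi\<^sup>2 * (1 + w) * r\<^sup>2 - 3 * (1 - w) * (1 - r\<^sup>2) powr (2 * \<nu> + 1)"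
  have cont: "continuous_on {0..1} ?f"
    using assms by (intro continuous_on_powr' continuous_intros) (auto simp: power_le_one)
  \<comment> \<open>At 1 the subtracted term vanishes, since \<open>0 powr x = 0\<close>.\<close>
  have f1: "0 < ?f 1"
    using assms M_const_ge_1[of p] by (simp add: mult_pos_pos)
  have "\<exists>!r. r \<in> {0<..<1} \<and> ?f r = 0"
    by (rule ex1_root_of_strict_mono[OF _ _ cont _ f1 radius1_fun_strict_mono[OF assms]]) (use assms in auto)
  moreover have "?f r = 0 \<longleftrightarrow> radius1_eq \<nu> p w r" for r
    unfolding radius1_eq_def by linarith
  ultimately show ?thesis by simp
qed

text \<open>Unique existence makes \<open>radius1\<close> a genuine root, and an increasing function
  is nonpositive up to its root. \<open>le_radius2_D\<close> rests on the same argument.\<close>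

lemma le_radius1_D:
  assumes "\<nu> > 0" "0 \<le> w" "w < 1" "0 \<le> r" "r \<le> radius1 \<nu> p w"
  shows "r < 1" "M_const p * pi\<^sup>2 * (1 + w) * r\<^sup>2 \<le> 3 * (1 - w) * (1 - r\<^sup>2) powr (2 * \<nu> + 1)"
proof -
  have rad: "radius1 \<nu> p w \<in> {0<..<1}" "radius1_eq \<nu> p w (radius1 \<nu> p w)"
    using theI'[OF radius1_ex1[of \<nu> w p]] assms unfolding radius1_def by blast+
  then show "r < 1" using assms by auto
  then show "M_const p * pi\<^sup>2 * (1 + w) * r\<^sup>2 \<le> 3 * (1 - w) * (1 - r\<^sup>2) powr (2 * \<nu> + 1)"
    using monotone_onD[OF strict_mono_on_imp_mono_on[OF radius1_fun_strict_mono[of \<nu> w p]], of r "radius1 \<nu> p w"]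
      rad assms by (auto simp: radius1_eq_def)
qed

lemma radius2_fun_strict_mono:
  assumes "0 \<le> w" "w < 1"
  shows "strict_mono_on {0..<1} (\<lambda>r. 2 * M_const p * (1 + w) * r * F_fun (k + 1) r - (1 - w) * (1 - r))"
proof (rule strict_mono_onI)
  fix r s :: real assume rs: "r \<in> {0..<1}" "s \<in> {0..<1}" "r < s"
  have "0 \<le> F_fun (k + 1) r" "F_fun (k + 1) r \<le> F_fun (k + 1) s"
    using F_fun_diff_ge[of 0 r "k + 1"] F_fun_diff_ge[of r s "k + 1"] rs by auto
  then have "2 * M_const p * (1 + w) * r * F_fun (k + 1) r \<le> 2 * M_const p * (1 + w) * s * F_fun (k + 1) s"
    using rs assms M_const_ge_1[of p] by (intro mult_mono mult_nonneg_nonneg) auto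
  moreover have "(1 - w) * (1 - s) < (1 - w) * (1 - r)"
    using rs assms by (intro mult_strict_left_mono) auto
  ultimately show "2 * M_const p * (1 + w) * r * F_fun (k + 1) r - (1 - w) * (1 - r)
      < 2 * M_const p * (1 + w) * s * F_fun (k + 1) s - (1 - w) * (1 - s)"
    by linarith
qed

lemma radius2_ex1:
  assumes "0 \<le> w" "w < 1"
  shows "\<exists>!r. r \<in> {0<..<1} \<and> radius2_eq k p w r"
proof -
  let ?f = "\<lambda>r. 2 * M_const p * (1 + w) * r * F_fun (k + 1) r - (1 - w) * (1 - r)"
  \<comment> \<open>At 3/4 the positive term is at least 9/8, while (1 - w)/4 is at most
    1/4.\<close>
  have "3 / 4 \<le> F_fun (k + 1) (3 / 4)"
    using F_fun_diff_ge[of 0 "3/4" "k + 1"] by simp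
  moreover have "2 * 1 * (1 + 0) \<le> 2 * M_const p * (1 + w)"
    using assms M_const_ge_1[of p] by (intro mult_mono) auto
  ultimately have "2 * (3 / 4) * (3 / 4) \<le> 2 * M_const p * (1 + w) * (3 / 4) * F_fun (k + 1) (3 / 4)"
    by (intro mult_mono) auto
  then have "0 < ?f (3 / 4)"
    using assms by simp
  then have "\<exists>!r. r \<in> {0<..<1} \<and> ?f r = 0"
    using assms
    by (intro ex1_root_of_strict_mono[of "3/4"] radius2_fun_strict_mono continuous_intros F_fun_continuous_on) auto
  then show ?thesis
    by (simp add: radius2_eq_def)
qed

lemma le_radius2_D:
  assumes "0 \<le> w" "w < 1" "0 \<le> r" "r \<le> radius2 k p w"
  shows "r < 1" "2 * M_const p * (1 + w) * r * F_fun (k + 1) r \<le> (1 - w) * (1 - r)"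
proof -
  have rad: "radius2 k p w \<in> {0<..<1}" "radius2_eq k p w (radius2 k p w)"
    using theI'[OF radius2_ex1[of w k p]] assms unfolding radius2_def by blast+
  then show "r < 1" using assms by auto
  then show "2 * M_const p * (1 + w) * r * F_fun (k + 1) r \<le> (1 - w) * (1 - r)"
    using monotone_onD[OF strict_mono_on_imp_mono_on[OF radius2_fun_strict_mono[of w p k]], of r "radius2 k p w"]
      rad assms by (auto simp: radius2_eq_def)
qed

section \<open>Derivative and coefficient bounds from the Bloch norm\<close>

lemma sense_preserving_canonical:
  assumes "canonical_decomposition f h g" "sense_preserving f" "z \<in> unit_disk"
  shows "cmod (deriv g z) < cmod (deriv h z)"
proof (rule power2_less_imp_less)
  show "(cmod (deriv g z))\<^sup>2 < (cmod (deriv h z))\<^sup>2"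
    using assms(2,3) unfolding sense_preserving_def by (auto simp: jacobian_canonical[OF assms(1,3)] dest!: bspec)
qed simp

lemma dilatation_less_1:
  assumes "canonical_decomposition f h g" "sense_preserving f" "z \<in> unit_disk"
  shows "cmod (dilatation f z) < 1"
  using sense_preserving_canonical[OF assms]
  by (simp add: dilatation_canonical[OF assms(1,3)] norm_divide divide_less_eq)

lemma bloch_weight_le_bloch_beta:
  assumes "f \<in> bloch_harmonic \<nu>" "z \<in> unit_disk"
  shows "bloch_weight \<nu> f z \<le> bloch_beta \<nu> f"
  unfolding bloch_beta_def using assms by (intro cSUP_upper) (auto simp: bloch_harmonic_def)

lemma bloch_beta_nonneg:
  assumes "f \<in> bloch_harmonic \<nu>"
  shows "0 \<le> bloch_beta \<nu> f"
proof -
  have "0 \<le> bloch_weight \<nu> f 0" by (simp add: bloch_weight_def)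
  also have "\<dots> \<le> bloch_beta \<nu> f"
    using assms by (intro bloch_weight_le_bloch_beta) auto
  finally show ?thesis .
qed

text \<open>The Bloch weight bounds \<open>\<rho> powr (2 * \<nu>)\<close> times the Jacobian |h'|^2
  (1 - |\<open>?\<omega>\<close>|^2). Schwarz-Pick bounds the last factor below by a multiple of
  \<open>\<rho>\<close>, which accounts for the extra 1 in the exponent.\<close>

lemma deriv_analytic_part_bound:
  assumes can: "canonical_decomposition f h g" and sp: "sense_preserving f"
    and bl: "f \<in> bloch_harmonic \<nu>" and z: "z \<in> unit_disk" and w: "w = cmod (dilatation f 0)"
  shows "(cmod (deriv h z))\<^sup>2 \<le> (1 + w) / (1 - w) * (bloch_beta \<nu> f)\<^sup>2 / (1 - (cmod z)\<^sup>2) powr (2 * \<nu> + 1)"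
proof -
  define \<rho> where "\<rho> = 1 - (cmod z)\<^sup>2"
  have \<rho>: "0 < \<rho>" using z by (simp add: \<rho>_def power_less_one_iff)
  have w1: "0 \<le> w" "w < 1"
    using dilatation_less_1[OF can sp, of 0] w by auto
  have h0: "deriv h x \<noteq> 0" if "x \<in> unit_disk" for x
    using sense_preserving_canonical[OF can sp that] by auto
  let ?\<omega> = "\<lambda>x. deriv g x / deriv h x"
  have "?\<omega> holomorphic_on unit_disk"
    using can h0 by (auto simp: canonical_decomposition_def intro!: holomorphic_intros)
  moreover have "cmod (?\<omega> x) < 1" if "cmod x < 1" for x
    using dilatation_less_1[OF can sp, of x] dilatation_canonical[OF can, of x] that by simp
  ultimately have "(1 - cmod (?\<omega> 0)) * (1 - (cmod z)\<^sup>2) \<le> (1 + cmod (?\<omega> 0)) * (1 - (cmod (?\<omega> z))\<^sup>2)"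
    using z by (intro Schwarz_Pick_norm) auto
  moreover have "cmod (?\<omega> 0) = w"
    using dilatation_canonical[OF can, of 0] w by simp
  ultimately have SP: "(1 - w) * \<rho> \<le> (1 + w) * (1 - (cmod (?\<omega> z))\<^sup>2)"
    by (simp add: \<rho>_def)
  have J: "jacobian f z = (cmod (deriv h z))\<^sup>2 * (1 - (cmod (?\<omega> z))\<^sup>2)"
    using h0[OF z] by (simp add: jacobian_canonical[OF can z] norm_divide power_divide right_diff_distrib)
  have Jpos: "0 < jacobian f z"
    using sp z by (simp add: sense_preserving_def)
  have "(bloch_weight \<nu> f z)\<^sup>2 \<le> (bloch_beta \<nu> f)\<^sup>2"
    using bloch_weight_le_bloch_beta[OF bl z] by (intro power_mono) (simp_all add: bloch_weight_def)
  then have "(\<rho> powr \<nu>)\<^sup>2 * jacobian f z \<le> (bloch_beta \<nu> f)\<^sup>2"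
    using Jpos by (simp add: bloch_weight_def power_mult_distrib \<rho>_def)
  moreover have "(\<rho> powr \<nu>)\<^sup>2 = \<rho> powr (2 * \<nu>)"
    by (simp add: power2_eq_square flip: powr_add)
  ultimately have weight: "\<rho> powr (2 * \<nu>) * jacobian f z \<le> (bloch_beta \<nu> f)\<^sup>2"
    by simp
  have "(cmod (deriv h z))\<^sup>2 * \<rho> powr (2 * \<nu>) * ((1 - w) * \<rho>)
      \<le> (cmod (deriv h z))\<^sup>2 * \<rho> powr (2 * \<nu>) * ((1 + w) * (1 - (cmod (?\<omega> z))\<^sup>2))"
    by (intro mult_left_mono SP) auto
  also have "\<dots> = (1 + w) * (\<rho> powr (2 * \<nu>) * jacobian f z)"
    by (simp add: J)
  also have "\<dots> \<le> (1 + w) * (bloch_beta \<nu> f)\<^sup>2"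
    using w1 by (intro mult_left_mono weight) auto
  finally have "(cmod (deriv h z))\<^sup>2 * (\<rho> powr (2 * \<nu>) * \<rho>) * (1 - w) \<le> (1 + w) * (bloch_beta \<nu> f)\<^sup>2"
    by (simp only: mult_ac)
  moreover have "\<rho> powr (2 * \<nu>) * \<rho> = \<rho> powr (2 * \<nu> + 1)"
    using \<rho> by (simp add: powr_add)
  ultimately have "(cmod (deriv h z))\<^sup>2 * \<rho> powr (2 * \<nu> + 1) * (1 - w) \<le> (1 + w) * (bloch_beta \<nu> f)\<^sup>2"
    by simp
  then show ?thesis
    using w1 \<rho> by (simp add: \<rho>_def[symmetric] pos_le_divide_eq mult_ac)
qed

text \<open>Bessel's inequality for the derivative of F on the circle of radius sqrt t, chosen so
  that squaring produces the powers t^n.\<close>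

lemma powser_deriv_bessel:
  fixes c :: "nat \<Rightarrow> complex"
  assumes sums: "\<And>z. z \<in> unit_disk \<Longrightarrow> (\<lambda>n. c n * z ^ n) sums F z" and hol: "F holomorphic_on unit_disk"
    and t: "0 \<le> t" "t < 1" and bound: "\<And>z. (cmod z)\<^sup>2 = t \<Longrightarrow> (cmod (deriv F z))\<^sup>2 \<le> K"
  shows "(\<Sum>n<N. (Suc n * cmod (c (Suc n)))\<^sup>2 * t ^ n) \<le> K"
proof -
  \<comment> \<open>A point on the circle shows that K is nonnegative, so that squaring sqrt K
    returns K.\<close>
  have "cmod (of_real (sqrt t)) ^ 2 = t" using t by simp
  then have K: "0 \<le> K" using bound[of "of_real (sqrt t)"] by (meson order_trans zero_le_power2)
  have "(\<lambda>n. diffs c n * z ^ n) sums deriv F z" if "cmod z < 1" for z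
    using that sums hol
    by (intro termdiffs_sums_strong[of 1 c F]) (auto intro: holomorphic_derivI[of _ unit_disk])
  then have "(\<Sum>n<N. (cmod (diffs c n) * sqrt t ^ n)\<^sup>2) \<le> (sqrt K)\<^sup>2"
  proof (rule powser_circle_bessel)
    fix z :: complex assume "cmod z = sqrt t"
    then have "(cmod z)\<^sup>2 = t" using t by simp
    then show "cmod (deriv F z) \<le> sqrt K"
      using bound by (intro real_le_rsqrt)
  qed (use t in auto)
  moreover have "(cmod (diffs c n) * sqrt t ^ n)\<^sup>2 = (Suc n * cmod (c (Suc n)))\<^sup>2 * t ^ n" for n
  proof -
    have "(sqrt t ^ n)\<^sup>2 = t ^ n"
      using t by (simp add: power_mult[symmetric] mult.commute[of n]) (simp add: power_mult)
    then show ?thesis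
      by (simp add: diffs_def norm_mult power_mult_distrib del: of_nat_Suc)
  qed
  ultimately show ?thesis
    using K by simp
qed

text \<open>Since |g'| < |h'|, the same bound serves both series, whence the factor 2; the norm
  comparison is applied term by term.\<close>

lemma coefficient_sum_bound:
  assumes can: "canonical_decomposition f h g" and sp: "sense_preserving f"
    and bl: "f \<in> bloch_harmonic \<nu>" and "p \<ge> 1" and w: "w = cmod (dilatation f 0)"
    and ha: "\<And>z. z \<in> unit_disk \<Longrightarrow> (\<lambda>n. a n * z ^ n) sums h z"
    and gb: "\<And>z. z \<in> unit_disk \<Longrightarrow> (\<lambda>n. b (Suc n) * z ^ Suc n) sums g z"
    and t: "0 \<le> t" "t < 1"
  shows "(\<Sum>n<N. (Suc n * (cmod (a (Suc n)) powr p + cmod (b (Suc n)) powr p) powr (1 / p))\<^sup>2 * t ^ n)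
    \<le> 2 * M_const p * ((1 + w) / (1 - w) * (bloch_beta \<nu> f)\<^sup>2) / (1 - t) powr (2 * \<nu> + 1)"
    (is "_ \<le> 2 * M_const p * ?K / ?d")
proof -
  let ?c = "\<lambda>n. (cmod (a (Suc n)) powr p + cmod (b (Suc n)) powr p) powr (1 / p)"
  have hol: "h holomorphic_on unit_disk" "g holomorphic_on unit_disk"
    using can by (auto simp: canonical_decomposition_def)
  have h: "(cmod (deriv h z))\<^sup>2 \<le> ?K / ?d" and g: "(cmod (deriv g z))\<^sup>2 \<le> ?K / ?d" if "(cmod z)\<^sup>2 = t" for z
  proof -
    have z: "z \<in> unit_disk"
      using that t by (simp add: power_less_one_iff flip: that)
    show "(cmod (deriv h z))\<^sup>2 \<le> ?K / ?d"
      using deriv_analytic_part_bound[OF can sp bl z w] that by simp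
    moreover have "(cmod (deriv g z))\<^sup>2 \<le> (cmod (deriv h z))\<^sup>2"
      using sense_preserving_canonical[OF can sp z] by (intro power_mono) auto
    ultimately show "(cmod (deriv g z))\<^sup>2 \<le> ?K / ?d" by linarith
  qed
  \<comment> \<open>The series of g starts at index 1 and leaves \<open>b 0\<close> arbitrary;
    setting this coefficient to 0 gives a full power series for g.\<close>
  define b' where "b' n = (case n of 0 \<Rightarrow> 0 | Suc _ \<Rightarrow> b n)" for n
  have gb': "(\<lambda>n. b' n * z ^ n) sums g z" if "z \<in> unit_disk" for z
    using gb[OF that] sums_Suc_iff[of "\<lambda>n. b' n * z ^ n" "g z"] by (simp add: b'_def)
  have A: "(\<Sum>n<N. (Suc n * cmod (a (Suc n)))\<^sup>2 * t ^ n) \<le> ?K / ?d"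
    using powser_deriv_bessel[OF ha hol(1) t h] .
  have "(\<Sum>n<N. (Suc n * cmod (b' (Suc n)))\<^sup>2 * t ^ n) \<le> ?K / ?d"
    using powser_deriv_bessel[OF gb' hol(2) t g] .
  then have B: "(\<Sum>n<N. (Suc n * cmod (b (Suc n)))\<^sup>2 * t ^ n) \<le> ?K / ?d"
    by (simp add: b'_def)
  have "(\<Sum>n<N. (Suc n * ?c n)\<^sup>2 * t ^ n) \<le>
      (\<Sum>n<N. M_const p * ((Suc n * cmod (a (Suc n)))\<^sup>2 * t ^ n + (Suc n * cmod (b (Suc n)))\<^sup>2 * t ^ n))"
  proof (rule sum_mono)
    fix n
    have "(real (Suc n))\<^sup>2 * t ^ n * (?c n)\<^sup>2
        \<le> (real (Suc n))\<^sup>2 * t ^ n * (M_const p * ((cmod (a (Suc n)))\<^sup>2 + (cmod (b (Suc n)))\<^sup>2))"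
      using t \<open>p \<ge> 1\<close> by (intro mult_left_mono lp_norm_le_M_const mult_nonneg_nonneg) auto
    then show "(Suc n * ?c n)\<^sup>2 * t ^ n \<le>
        M_const p * ((Suc n * cmod (a (Suc n)))\<^sup>2 * t ^ n + (Suc n * cmod (b (Suc n)))\<^sup>2 * t ^ n)"
      by (simp only: power_mult_distrib distrib_left mult_ac)
  qed
  also have "\<dots> = M_const p * ((\<Sum>n<N. (Suc n * cmod (a (Suc n)))\<^sup>2 * t ^ n) + (\<Sum>n<N. (Suc n * cmod (b (Suc n)))\<^sup>2 * t ^ n))"
    by (simp only: sum.distrib sum_distrib_left[symmetric])
  also have "\<dots> \<le> M_const p * (?K / ?d + ?K / ?d)"
    using M_const_ge_1[of p] by (intro mult_left_mono add_mono A B) auto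
  also have "\<dots> = 2 * M_const p * ?K / ?d" by simp
  finally show ?thesis .
qed

section \<open>Partial sums below either radius\<close>

theorem theorem8:
  fixes \<nu> p w :: real and k :: nat
    and f h g :: "complex \<Rightarrow> complex" and a b :: "nat \<Rightarrow> complex"
  assumes "\<nu> > 0"
    and "real k / 2 < \<nu>" and "\<nu> \<le> (real k + 1) / 2"
    and "p \<ge> 1"
    and "f \<in> bloch_harmonic \<nu>"
    and "canonical_decomposition f h g"
    and "sense_preserving f"
    and "\<And>z. z \<in> unit_disk \<Longrightarrow> (\<lambda>n. a n * z ^ n) sums h z"
    and "\<And>z. z \<in> unit_disk \<Longrightarrow> (\<lambda>n. b (Suc n) * z ^ Suc n) sums g z"
    and "bloch_norm \<nu> f \<le> 1"
    and "w = cmod (dilatation f 0)"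
  shows "(\<exists>!r. r \<in> {0<..<1} \<and> radius1_eq \<nu> p w r) \<and>
    (\<exists>!r. r \<in> {0<..<1} \<and> radius2_eq k p w r) \<and>
    (\<forall>r. 0 \<le> r \<and> r \<le> max (radius1 \<nu> p w) (radius2 k p w) \<longrightarrow>
      summable (\<lambda>n. (cmod (a (Suc n)) powr p + cmod (b (Suc n)) powr p) powr (1 / p) * r ^ Suc n) \<and>
      cmod (a 0) +
        (\<Sum>n. (cmod (a (Suc n)) powr p + cmod (b (Suc n)) powr p) powr (1 / p) * r ^ Suc n) \<le> 1)"
proof (intro conjI allI impI)
  have w: "0 \<le> w" "w < 1"
    using dilatation_less_1[OF assms(6,7), of 0] assms(11) by auto
  show "\<exists>!r. r \<in> {0<..<1} \<and> radius1_eq \<nu> p w r" "\<exists>!r. r \<in> {0<..<1} \<and> radius2_eq k p w r"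
    using radius1_ex1 radius2_ex1 w assms(1) by auto
  fix r assume r: "0 \<le> r \<and> r \<le> max (radius1 \<nu> p w) (radius2 k p w)"
  define c where "c n = (cmod (a (Suc n)) powr p + cmod (b (Suc n)) powr p) powr (1 / p)" for n
  define \<beta> where "\<beta> = bloch_beta \<nu> f"
  define C where "C = 2 * M_const p * ((1 + w) / (1 - w) * \<beta>\<^sup>2)"
  have \<beta>: "0 \<le> \<beta>" unfolding \<beta>_def by (rule bloch_beta_nonneg) fact
  have C: "0 \<le> C" using w M_const_ge_1[of p] by (simp add: C_def)
  \<comment> \<open>As g vanishes at 0, the norm hypothesis leaves exactly the room 1 - |a_0| for
    \<open>\<beta>\<close>. All terms being nonnegative, it suffices to bound every partial sum by
    \<open>\<beta>\<close>.\<close>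
  have "f 0 = a 0"
    using assms(8)[of 0] assms(6) powser_sums_zero_iff[of a "h 0"] by (simp add: canonical_decomposition_def)
  then have a0: "cmod (a 0) + \<beta> \<le> 1"
    using assms(10) by (simp add: bloch_norm_def \<beta>_def)
  have S: "(\<Sum>n<N. (Suc n * c n)\<^sup>2 * t ^ n) \<le> C / (1 - t) powr (2 * \<nu> + 1)" if "0 \<le> t" "t < 1" for t N
    unfolding c_def C_def \<beta>_def
    by (rule coefficient_sum_bound[OF assms(6,7,5,4,11,8,9) that])
  have partial: "(\<Sum>n<N. c n * r ^ Suc n) \<le> \<beta>" for N
  proof -
    \<comment> \<open>A number below the maximum of the radii is below one of them, and each has its
      own estimate.\<close>
    have "(\<Sum>n<N. c n * r ^ Suc n)\<^sup>2 \<le> \<beta>\<^sup>2"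
    proof (cases "r \<le> radius1 \<nu> p w")
      case True
      then have r1: "r < 1" "M_const p * pi\<^sup>2 * (1 + w) * r\<^sup>2 \<le> 3 * (1 - w) * (1 - r\<^sup>2) powr (2 * \<nu> + 1)"
        using le_radius1_D[of \<nu> w r p] assms(1) w r by auto
      define d where "d = (1 - r\<^sup>2) powr (2 * \<nu> + 1)"
      have r2: "0 \<le> r\<^sup>2" "r\<^sup>2 < 1" using r r1 by (auto simp: power_less_one_iff)
      then have d: "0 < d" by (simp add: d_def)
      have "(\<Sum>n<N. c n * r ^ Suc n)\<^sup>2 \<le> (\<Sum>n<N. (Suc n * c n)\<^sup>2 * (r\<^sup>2) ^ n) * (r\<^sup>2 * pi\<^sup>2 / 6)"
        using r by (intro partial_sum_sq_le_inverse_squares) auto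
      also have "\<dots> \<le> C / d * (r\<^sup>2 * pi\<^sup>2 / 6)"
        unfolding d_def by (intro mult_right_mono S r2) auto
      \<comment> \<open>The 2 in \<open>C\<close> against the 6 of the Basel sum leaves the 3 of the
        first radius equation; the quotient is at most 1 by \<open>r1\<close>.\<close>
      also have "\<dots> = \<beta>\<^sup>2 * ((M_const p * pi\<^sup>2 * (1 + w) * r\<^sup>2) / (3 * (1 - w) * d))"
        using w d by (simp add: C_def field_simps)
      also have "\<dots> \<le> \<beta>\<^sup>2 * 1"
        using r1 w d by (intro mult_left_mono) (auto simp: d_def[symmetric] divide_le_eq_1)
      finally show ?thesis by simp
    next
      case False
      then have r1: "r < 1" "2 * M_const p * (1 + w) * r * F_fun (k + 1) r \<le> (1 - w) * (1 - r)"
        using le_radius2_D[of w r k p] w r by auto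
      have "(\<Sum>n<N. (Suc n * c n)\<^sup>2 * t ^ n) \<le> C / (1 - t) ^ Suc (k + 1)" if t: "0 \<le> t" "t < 1" for t
      proof -
        \<comment> \<open>Since 0 < 1 - t <= 1 and 2 \<open>\<nu>\<close> + 1 <= k + 2, the larger
          exponent gives the smaller power.\<close>
        have "(1 - t) ^ Suc (k + 1) = (1 - t) powr real (Suc (k + 1))"
          using t by (simp only: powr_realpow diff_gt_0_iff_gt)
        also have "\<dots> \<le> (1 - t) powr (2 * \<nu> + 1)"
          using t assms(3) by (intro powr_mono') auto
        finally have "C / (1 - t) powr (2 * \<nu> + 1) \<le> C / (1 - t) ^ Suc (k + 1)"
          using t C by (intro divide_left_mono) auto
        then show ?thesis using S[OF t, of N] by linarith
      qed
      then have F: "(\<Sum>n<N. (c n)\<^sup>2 * r ^ Suc n) \<le> C * F_fun (k + 1) r"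
        using r r1 by (intro sum_power_le_F_fun) auto
      have "(\<Sum>n<N. c n * r ^ Suc n)\<^sup>2 \<le> (\<Sum>n<N. (c n)\<^sup>2 * r ^ Suc n) * (r / (1 - r))"
        using r r1 by (intro partial_sum_sq_le_geometric) auto
      also have "\<dots> \<le> C * F_fun (k + 1) r * (r / (1 - r))"
        using r r1 by (intro mult_right_mono F) auto
      \<comment> \<open>The quotient compares the two terms of the second radius equation.\<close>
      also have "\<dots> = \<beta>\<^sup>2 * ((2 * M_const p * (1 + w) * r * F_fun (k + 1) r) / ((1 - w) * (1 - r)))"
        using w r1 by (simp add: C_def field_simps)
      also have "\<dots> \<le> \<beta>\<^sup>2 * 1"
        using r1 w by (intro mult_left_mono) (auto simp: divide_le_eq_1)
      finally show ?thesis by simp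
    qed
    then show ?thesis using \<beta> by (rule power2_le_imp_le)
  qed
  have "summable (\<lambda>n. c n * r ^ Suc n)"
    by (rule summableI_nonneg_bounded[OF _ partial]) (use r in \<open>simp add: c_def\<close>)
  then show "summable (\<lambda>n. (cmod (a (Suc n)) powr p + cmod (b (Suc n)) powr p) powr (1 / p) * r ^ Suc n)"
    and "cmod (a 0) + (\<Sum>n. (cmod (a (Suc n)) powr p + cmod (b (Suc n)) powr p) powr (1 / p) * r ^ Suc n) \<le> 1"
    using suminf_le_const[OF _ partial] a0 unfolding c_def by fastforce+
qed

end
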